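(* Let $(a_k)_{k\ge0}$ be a sequence of (possibly dependent) complex random variables such that the moduli $|a_k|$ have densities which are uniformly bounded in a neighbourhood of the origin. Assume that there exists some $s\in(0,1]$ such that, with $\lambda_k:=\mathbb E[|a_k|^s]$, one has $\lambda_k<\infty$ for all $k$ and $$\limsup_{k\to\infty}(\lambda_k)^{1/k}=1.$$ Then almost surely the zeros of the random polynomials $P_N(Z)=\sum_{k=0}^N a_kZ^k$ cluster uniformly around the unit circle as $N\to\infty$.
   Context: All random variables are defined on one probability space, with expectation $\mathbb E$. The density assumption means that each $|a_k|$ has a density $f_k$ on $[0,\infty)$ with respect to Lebesgue measure and there are constants $\delta>0$, $M<\infty$ independent of $k$ with $f_k(x)\le M$ for all $x\in[0,\delta]$ and all $k\ge 0$. For $N\ge1$ let $z_1,\dots,z_N$ be the complex zeros of $P_N$, counted with multiplicity (almost surely $a_0a_N\ne0$). For $0<\rho<1$, $\nu_N(\rho)=\#\{k:1-\rho\le|z_k|\le\frac1{1-\rho}\}$; for $0\le\theta<\phi\le2\pi$, $\nu_N(\theta,\phi)=\#\{k:\theta\le\arg(z_k)<\phi\}$, where the argument takes values in $[0,2\pi)$. The zeros of the sequence $(P_N)$ are said to cluster uniformly around the unit circle if for all fixed $0<\rho<1$, $\lim_{N\to\infty}\frac1N\nu_N(\rho)=1$, and for all $0\le\theta<\phi\le2\pi$, $\lim_{N\to\infty}\frac1N\nu_N(\theta,\phi)=\frac{\phi-\theta}{2\pi}$. *)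

theory Defs
  imports
    "HOL-Probability.Probability"
    "HOL-Computational_Algebra.Computational_Algebra"
begin

definition random_poly :: "(nat \<Rightarrow> 'w \<Rightarrow> complex) \<Rightarrow> nat \<Rightarrow> 'w \<Rightarrow> complex poly" where
  "random_poly a N \<omega> = (\<Sum>k\<le>N. monom (a k \<omega>) k)"

definition zeros_in_annulus :: "complex poly \<Rightarrow> real \<Rightarrow> nat" where
  "zeros_in_annulus p \<rho> =
     size {#z \<in># proots p. 1 - \<rho> \<le> cmod z \<and> cmod z \<le> 1 / (1 - \<rho>)#}"

definition zeros_in_sector :: "complex poly \<Rightarrow> real \<Rightarrow> real \<Rightarrow> nat" where
  "zeros_in_sector p \<theta> \<phi> = size {#z \<in># proots p. \<theta> \<le> Arg2pi z \<and> Arg2pi z < \<phi>#}"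

(* The counts are divided by the index N, not by degree (P N). *)
definition zeros_cluster_uniformly :: "(nat \<Rightarrow> complex poly) \<Rightarrow> bool" where
  "zeros_cluster_uniformly P \<longleftrightarrow>
     (\<forall>\<rho>. 0 < \<rho> \<and> \<rho> < 1 \<longrightarrow>
        (\<lambda>N. real (zeros_in_annulus (P N) \<rho>) / real N) \<longlonglongrightarrow> 1) \<and>
     (\<forall>\<theta> \<phi>. 0 \<le> \<theta> \<and> \<theta> < \<phi> \<and> \<phi> \<le> 2 * pi \<longrightarrow>
        (\<lambda>N. real (zeros_in_sector (P N) \<theta> \<phi>) / real N) \<longlonglongrightarrow> (\<phi> - \<theta>) / (2 * pi))"

(* The densities are taken on the whole line. For nonnegative X k, such as moduli, they vanish
   almost everywhere on the negative axis, so they are densities on [0, infinity). *)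
definition densities_bounded_near_0 :: "'w measure \<Rightarrow> (nat \<Rightarrow> 'w \<Rightarrow> real) \<Rightarrow> bool" where
  "densities_bounded_near_0 M X \<longleftrightarrow>
     (\<exists>(f :: nat \<Rightarrow> real \<Rightarrow> real) \<delta> B. \<delta> > 0 \<and>
        (\<forall>k. (\<forall>x. 0 \<le> f k x) \<and>
             distributed M lborel (X k) (\<lambda>x. ennreal (f k x)) \<and>
             (\<forall>x\<in>{0..\<delta>}. f k x \<le> B)))"

end

theory Submission
  imports
    Defs
    "HOL-Complex_Analysis.Conformal_Mappings"
    "HOL-Real_Asymp.Real_Asymp"
begin

text \<open>
  The statement separates into a probabilistic and a deterministic part. Almost surely all \<open>a k\<close> are
  nonzero and \<open>|a k|\<close> to the power \<open>1 / k\<close> tends to \<open>1\<close>: the moment condition keeps \<open>|a k|\<close> from being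
  exponentially large by Markov's inequality (\<open>AE_eventually_le_exp\<close>), the density bound keeps it
  from being exponentially small (\<open>AE_eventually_exp_le\<close>), and in both cases the exceptional
  probabilities are summable, so that Borel--Cantelli applies. It remains to prove that zeros cluster
  for every fixed sequence of coefficients with these properties.
  
  The moduli are governed by Landau's inequality. It bounds \<open>R ^ n\<close>, where \<open>n\<close> is the number of zeros of
  modulus larger than \<open>R\<close>, by the sum of the \<open>|a k|\<close> with \<open>k \<le> N\<close> divided by \<open>|a N|\<close>; for the
  zeros of modulus less than \<open>1 / R\<close> the divisor is \<open>|a 0|\<close> (\<open>number_of_zeros_off_annulus\<close>). Both quotients grow
  subexponentially in \<open>N\<close>, so \<open>n\<close> is \<open>o(N)\<close>.
  
  For the arguments, Weyl's criterion asks that for each \<open>m \<ge> 1\<close> the mean of \<open>(z / |z|) ^ m\<close> over the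
  zeros tends to \<open>0\<close>. Instead of a quantitative estimate of Erdos--Turan type, the proof uses that by
  Newton's identities the sum of \<open>1 / z ^ m\<close> over the zeros is determined by the coefficients up to
  degree \<open>m\<close>; hence it does not depend on \<open>N \<ge> m\<close>, and its mean is \<open>O(1 / N)\<close>
  (\<open>inverse_power_sums_eq\<close>). Since all but \<open>o(N)\<close> zeros are close to the unit circle and all zeros stay
  away from \<open>0\<close>, the points \<open>z\<close> may be replaced by \<open>z / |z|\<close> here (\<open>Weyl_sums_tendsto_0\<close>), and complex
  conjugation turns the inverse powers into powers.
\<close>

section \<open>Zeros off the unit circle\<close>

lemma power_size_filter_le_prod_mset:
  fixes f :: "'a \<Rightarrow> real"
  assumes "\<And>x. x \<in># A \<Longrightarrow> 1 \<le> f x" and "0 \<le> R"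
  shows "R ^ size {#x \<in># A. R < f x#} \<le> (\<Prod>x\<in>#A. f x)"
  using assms(1)
proof (induction A)
  case (add x A)
  have IH: "R ^ size {#x \<in># A. R < f x#} \<le> (\<Prod>x\<in>#A. f x)"
    using add by simp
  have nn: "0 \<le> R ^ size {#x \<in># A. R < f x#}" using assms(2) by simp
  show ?case
  proof (cases "R < f x")
    case True
    then show ?thesis using mult_mono[OF less_imp_le[OF True] IH] assms(2) nn by auto
  next
    case False
    have "1 \<le> f x" using add.prems by simp
    then show ?thesis using mult_mono[OF _ IH, of 1 "f x"] nn False by auto
  qed
qed simp

text \<open>
  This is Landau's inequality for the Mahler measure, with the sum of the moduli of the coefficients in
  place of their \<open>l\<^sup>2\<close>-norm. Replacing a factor \<open>z - w\<close> with \<open>|w| < 1\<close> by \<open>1 - cnj w * z\<close> does not change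
  the modulus on the unit circle. Once all these factors are replaced, the value at \<open>0\<close> has as its
  modulus the product on the left, so the maximum principle gives the bound.
\<close>
lemma Landau_bound:
  fixes p :: "complex poly"
  shows "cmod (lead_coeff p) * (\<Prod>w\<in>#proots p. max 1 (cmod w)) \<le> (\<Sum>k\<le>degree p. cmod (coeff p k))"
proof -
  define h where "h = (\<lambda>w z. if 1 \<le> cmod w then z - w else 1 - cnj w * z)"
  define g where "g z = lead_coeff p * (\<Prod>w\<in>#proots p. h w z)" for z
  have circle: "cmod (h w z) = cmod (z - w)" if "cmod z = 1" for w z
  proof (cases "1 \<le> cmod w")
    case False
    have "cnj z * z = 1"
      using complex_norm_square[of z] that by (simp add: mult.commute)
    then have "1 - cnj w * z = cnj (z - w) * z"
      by (simp add: algebra_simps)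
    then have "cmod (1 - cnj w * z) = cmod (cnj (z - w)) * cmod z"
      by (simp only: norm_mult)
    then show ?thesis
      using False that unfolding h_def by (simp del: complex_cnj_diff)
  qed (simp add: h_def)
  have prod_norm: "cmod (\<Prod>w\<in>#A. f w) = (\<Prod>w\<in>#A. cmod (f w))" for A :: "complex multiset" and f
    by (induction A) (auto simp: norm_mult)
  have poly_prod: "poly p z = lead_coeff p * (\<Prod>w\<in>#proots p. z - w)" for z
    using arg_cong[OF complex_poly_decompose_multiset[of p], of "\<lambda>q. poly q z"]
    by (simp add: poly_prod_mset multiset.map_comp o_def)
  have hol: "(\<lambda>z. \<Prod>w\<in>#A. h w z) holomorphic_on UNIV" for A
  proof (induction A)
    case (add w A)
    have "h w holomorphic_on UNIV"
      by (cases "1 \<le> cmod w") (auto simp: h_def intro!: holomorphic_intros)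
    then show ?case
      using add by (auto intro: holomorphic_intros)
  qed simp
  have ghol: "g holomorphic_on UNIV"
    unfolding g_def using hol by (intro holomorphic_intros)
  have bound: "cmod (g z) \<le> (\<Sum>k\<le>degree p. cmod (coeff p k))" if "cmod z = 1" for z
  proof -
    have "cmod (g z) = cmod (poly p z)"
      unfolding g_def poly_prod norm_mult prod_norm circle[OF that] ..
    also have "\<dots> \<le> (\<Sum>k\<le>degree p. cmod (coeff p k * z ^ k))"
      unfolding poly_altdef by (rule norm_sum)
    finally show ?thesis by (simp add: norm_mult norm_power that)
  qed
  have "cmod (g 0) \<le> (\<Sum>k\<le>degree p. cmod (coeff p k))"
  proof (rule maximum_modulus_frontier[where f = g and S = "cball 0 1" and \<xi> = 0])
    show "g holomorphic_on interior (cball 0 1)"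
      using ghol holomorphic_on_subset by blast
    show "continuous_on (closure (cball 0 1)) g"
      using ghol holomorphic_on_imp_continuous_on continuous_on_subset by blast
  qed (use bound in auto)
  moreover have "cmod (h w 0) = max 1 (cmod w)" for w
    by (simp add: h_def)
  ultimately show ?thesis
    by (simp add: g_def norm_mult prod_norm)
qed

text \<open>
  Each zero with \<open>|z| > R\<close> contributes a factor larger than \<open>R\<close> to Landau's product, which bounds the
  number of large zeros. The small ones are treated in the same way: the product of all \<open>|z|\<close> is
  \<open>|p(0)|\<close> divided by the modulus of the leading coefficient, and dividing Landau's product by it turns
  \<open>max 1 |z|\<close> into \<open>max 1 (1 / |z|)\<close>.
\<close>
lemma number_of_zeros_off_annulus:
  fixes p :: "complex poly"
  assumes p0: "coeff p 0 \<noteq> 0" and "1 \<le> R"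
  defines "S \<equiv> \<Sum>k\<le>degree p. cmod (coeff p k)"
  shows "cmod (lead_coeff p) * R ^ size {#z \<in># proots p. R < cmod z#} \<le> S"
    and "cmod (coeff p 0) * R ^ size {#z \<in># proots p. R < 1 / cmod z#} \<le> S"
proof -
  have p: "p \<noteq> 0" using p0 by auto
  have filter: "{#z \<in># proots p. R < f z#} = {#z \<in># proots p. R < max 1 (f z)#}" for f
    using \<open>1 \<le> R\<close> by (intro filter_mset_cong) auto
  have pow: "R ^ size {#z \<in># proots p. R < f z#} \<le> (\<Prod>z\<in>#proots p. max 1 (f z))" for f
    unfolding filter[of f] using \<open>1 \<le> R\<close> by (intro power_size_filter_le_prod_mset) auto
  have max_prod: "(\<Prod>z\<in>#A. max 1 (1 / cmod z)) * (\<Prod>z\<in>#A. cmod z) = (\<Prod>z\<in>#A. max 1 (cmod z))"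
    if "0 \<notin># A" for A
    using that
  proof (induction A)
    case (add z A)
    have "max 1 (1 / cmod z) * cmod z = max 1 (cmod z)"
      using add.prems by (auto simp: max_def field_simps)
    then show ?case
      using add by (simp add: mult_ac)
  qed simp
  have "0 \<notin># proots p"
    using p p0 by (simp add: poly_0_coeff_0)
  have prod_norm: "cmod (\<Prod>w\<in>#A. - w) = (\<Prod>w\<in>#A. cmod w)" for A :: "complex multiset"
    by (induction A) (auto simp: norm_mult)
  have "poly p 0 = lead_coeff p * (\<Prod>w\<in>#proots p. - w)"
    using arg_cong[OF complex_poly_decompose_multiset[of p], of "\<lambda>q. poly q 0"]
    by (simp add: poly_prod_mset multiset.map_comp o_def)
  then have a0: "cmod (coeff p 0) = cmod (lead_coeff p) * (\<Prod>w\<in>#proots p. cmod w)"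
    by (simp add: poly_0_coeff_0 norm_mult prod_norm)
  have "cmod (lead_coeff p) * R ^ size {#z \<in># proots p. R < cmod z#}
      \<le> cmod (lead_coeff p) * (\<Prod>z\<in>#proots p. max 1 (cmod z))"
    by (intro mult_left_mono pow) simp
  also have "\<dots> \<le> S" unfolding S_def by (rule Landau_bound)
  finally show "cmod (lead_coeff p) * R ^ size {#z \<in># proots p. R < cmod z#} \<le> S" .
  have "cmod (coeff p 0) * R ^ size {#z \<in># proots p. R < 1 / cmod z#}
      \<le> cmod (coeff p 0) * (\<Prod>z\<in>#proots p. max 1 (1 / cmod z))"
    by (intro mult_left_mono pow) simp
  also have "\<dots> = cmod (lead_coeff p) * (\<Prod>z\<in>#proots p. max 1 (cmod z))"
    unfolding a0 max_prod[OF \<open>0 \<notin># proots p\<close>, symmetric] by (simp add: mult_ac)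
  also have "\<dots> \<le> S" unfolding S_def by (rule Landau_bound)
  finally show "cmod (coeff p 0) * R ^ size {#z \<in># proots p. R < 1 / cmod z#} \<le> S" .
qed

section \<open>Inverse power sums of the zeros\<close>

text \<open>
  The logarithmic derivative of \<open>X - z\<close> is \<open>1 / (X - z)\<close>, a geometric series in \<open>X / z\<close>; the logarithmic
  derivative of the product is therefore the generating function of the inverse power sums, up to sign.
\<close>
lemma fps_log_deriv_linear_factors:
  fixes A :: "complex multiset"
  assumes "0 \<notin># A"
  shows "fps_deriv (fps_of_poly (\<Prod>z\<in>#A. [:-z, 1:]))
    = - (fps_of_poly (\<Prod>z\<in>#A. [:-z, 1:]) * Abs_fps (\<lambda>m. \<Sum>z\<in>#A. inverse z ^ Suc m))"
  using assms
proof (induction A)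
  case empty
  then show ?case by (auto intro: fps_ext)
next
  case (add z A)
  let ?q = "fps_of_poly (\<Prod>z\<in>#A. [:-z, 1:])"
  let ?S = "Abs_fps (\<lambda>m. \<Sum>z\<in>#A. inverse z ^ Suc m)"
  let ?G = "Abs_fps (\<lambda>m. inverse z ^ Suc m)"
  have z: "z \<noteq> 0" using add.prems by auto
  have IH: "fps_deriv ?q = - (?q * ?S)" using add by simp
  have lin: "fps_of_poly [:-z, 1:] = fps_X - fps_const z"
    by (simp add: fps_of_poly_linear)
  have geom: "(fps_X - fps_const z) * ?G = -1"
  proof (rule fps_ext)
    fix n
    show "((fps_X - fps_const z) * ?G) $ n = (-1) $ n"
      using z by (cases n) (simp_all add: left_diff_distrib)
  qed
  have sum: "Abs_fps (\<lambda>m. \<Sum>z\<in>#add_mset z A. inverse z ^ Suc m) = ?G + ?S"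
    by (rule fps_ext) simp
  have "fps_deriv ((fps_X - fps_const z) * ?q) = ?q - (fps_X - fps_const z) * ?q * ?S"
    by (simp add: IH algebra_simps)
  also have "\<dots> = - ((fps_X - fps_const z) * ?q * (?G + ?S))"
    using arg_cong[OF geom, of "\<lambda>x. x * ?q"] by (simp add: algebra_simps)
  finally show ?case
    unfolding sum by (simp only: image_mset_add_mset prod_mset.add_mset fps_of_poly_mult lin)
qed

lemma Newton_identity_inverse_roots:
  fixes p :: "complex poly"
  assumes "coeff p 0 \<noteq> 0"
  shows "of_nat (Suc m) * coeff p (Suc m)
    = - (\<Sum>i\<le>m. coeff p i * (\<Sum>z\<in>#proots p. inverse z ^ Suc (m - i)))"
proof -
  let ?q = "\<Prod>z\<in>#proots p. [:-z, 1:]"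
  have "p \<noteq> 0" using assms by auto
  then have "0 \<notin># proots p" using assms by (simp add: poly_0_coeff_0)
  note log_deriv = fps_log_deriv_linear_factors[OF this]
  have p: "fps_of_poly p = fps_const (lead_coeff p) * fps_of_poly ?q"
    using arg_cong[OF complex_poly_decompose_multiset[of p], of fps_of_poly]
    by (simp add: fps_of_poly_smult)
  have "fps_deriv (fps_of_poly p)
      = - (fps_of_poly p * Abs_fps (\<lambda>m. \<Sum>z\<in>#proots p. inverse z ^ Suc m))"
    unfolding p by (simp add: log_deriv mult.assoc)
  from arg_cong[OF this, of "\<lambda>f. f $ m"] show ?thesis
    by (simp add: fps_mult_nth atMost_atLeast0)
qed

text \<open>
  Newton's identities determine the inverse power sums recursively from the lowest coefficients. Hence
  adding terms of higher degree to a polynomial moves all of its zeros but keeps these sums.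
\<close>
lemma inverse_power_sums_eq:
  fixes p q :: "complex poly"
  assumes p0: "coeff p 0 \<noteq> 0" and "\<And>k. k \<le> n \<Longrightarrow> coeff p k = coeff q k" and "m < n"
  shows "(\<Sum>z\<in>#proots p. inverse z ^ Suc m) = (\<Sum>z\<in>#proots q. inverse z ^ Suc m)"
  using \<open>m < n\<close>
proof (induction m rule: less_induct)
  case (less m)
  have q0: "coeff q 0 \<noteq> 0" using assms by auto
  have split: "(\<Sum>i\<le>m. f i) = f 0 + (\<Sum>i\<in>{1..m}. f i)" for f :: "nat \<Rightarrow> complex"
    by (simp add: atMost_atLeast0 sum.atLeast_Suc_atMost)
  have "(\<Sum>i\<in>{1..m}. coeff p i * (\<Sum>z\<in>#proots p. inverse z ^ Suc (m - i)))
      = (\<Sum>i\<in>{1..m}. coeff q i * (\<Sum>z\<in>#proots q. inverse z ^ Suc (m - i)))"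
    using less assms(2) by (intro sum.cong refl arg_cong2[where f = "(*)"]) auto
  then have "coeff p 0 * (\<Sum>z\<in>#proots p. inverse z ^ Suc m)
      = coeff p 0 * (\<Sum>z\<in>#proots q. inverse z ^ Suc m)"
    using Newton_identity_inverse_roots[OF p0, of m] Newton_identity_inverse_roots[OF q0, of m]
      assms(2)[of 0] assms(2)[of "Suc m"] less.prems
    unfolding split[of "\<lambda>i. coeff p i * _ i"] split[of "\<lambda>i. coeff q i * _ i"] by simp
  then show ?case using p0 by simp
qed

section \<open>Weyl's criterion on the circle\<close>

definition circle_mean :: "complex multiset \<Rightarrow> (complex \<Rightarrow> 'a::real_normed_field) \<Rightarrow> 'a" where
  "circle_mean A g = (\<Sum>z\<in>#A. g (sgn z)) / of_nat (size A)"

text \<open>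
  Equidistribution of the directions \<open>z / |z|\<close>, tested on the single function \<open>g\<close>. The limit is quantified
  existentially and tied to the integral by \<open>has_integral\<close>, so that the functions \<open>g\<close> with this property
  visibly form a complex vector space.
\<close>
definition averages_to_integral :: "(nat \<Rightarrow> complex multiset) \<Rightarrow> (complex \<Rightarrow> complex) \<Rightarrow> bool" where
  "averages_to_integral Z g \<longleftrightarrow>
     (\<exists>L. (\<lambda>N. circle_mean (Z N) g) \<longlonglongrightarrow> L \<and> ((\<lambda>t. g (cis t)) has_integral of_real (2 * pi) * L) {0..2*pi})"

lemma circle_mean_cong:
  assumes "0 \<notin># A" and "\<And>z. cmod z = 1 \<Longrightarrow> f z = g z"
  shows "circle_mean A f = circle_mean A g"
proof -
  have "image_mset (\<lambda>z. f (sgn z)) A = image_mset (\<lambda>z. g (sgn z)) A"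
    using assms by (intro image_mset_cong) (metis norm_sgn)
  then show ?thesis by (simp add: circle_mean_def)
qed

lemma circle_mean_add: "circle_mean A (\<lambda>z. f z + g z) = circle_mean A f + circle_mean A g"
  by (simp add: circle_mean_def sum_mset.distrib add_divide_distrib)

lemma circle_mean_cmult: "circle_mean A (\<lambda>z. c * f z) = c * circle_mean A f"
  by (simp add: circle_mean_def sum_mset_distrib_left)

lemma circle_mean_const: "A \<noteq> {#} \<Longrightarrow> circle_mean A (\<lambda>z. c) = c"
  by (simp add: circle_mean_def)

lemma averages_add:
  assumes "averages_to_integral Z f" "averages_to_integral Z g"
  shows "averages_to_integral Z (\<lambda>z. f z + g z)"
proof -
  obtain K L where "(\<lambda>N. circle_mean (Z N) f) \<longlonglongrightarrow> K" "((\<lambda>t. f (cis t)) has_integral of_real (2 * pi) * K) {0..2*pi}"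
    "(\<lambda>N. circle_mean (Z N) g) \<longlonglongrightarrow> L" "((\<lambda>t. g (cis t)) has_integral of_real (2 * pi) * L) {0..2*pi}"
    using assms unfolding averages_to_integral_def by blast
  then show ?thesis
    unfolding averages_to_integral_def circle_mean_add
    by (intro exI[of _ "K + L"]) (auto simp: distrib_left intro: tendsto_add has_integral_add)
qed

lemma averages_cmult:
  assumes "averages_to_integral Z f"
  shows "averages_to_integral Z (\<lambda>z. c * f z)"
proof -
  obtain K where K: "(\<lambda>N. circle_mean (Z N) f) \<longlonglongrightarrow> K" "((\<lambda>t. f (cis t)) has_integral of_real (2 * pi) * K) {0..2*pi}"
    using assms unfolding averages_to_integral_def by blast
  have "((\<lambda>t. c * f (cis t)) has_integral of_real (2 * pi) * (c * K)) {0..2*pi}"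
    using has_integral_mult_right[OF K(2), of c] by (simp add: mult_ac)
  then show ?thesis
    using K(1) unfolding averages_to_integral_def circle_mean_cmult
    by (intro exI[of _ "c * K"]) (auto intro: tendsto_mult)
qed

lemma averages_sum:
  assumes "finite I" and "averages_to_integral Z (\<lambda>z. 0)" and "\<And>i. i \<in> I \<Longrightarrow> averages_to_integral Z (f i)"
  shows "averages_to_integral Z (\<lambda>z. \<Sum>i\<in>I. f i z)"
  using assms by (induction I) (auto intro: averages_add)

lemma has_integral_cis_power:
  assumes "m > 0"
  shows "((\<lambda>t. cis t ^ m) has_integral 0) {0..2*pi}"
proof -
  have "((\<lambda>t. cis t ^ m) has_integral (cis (2*pi) ^ m / (\<i> * of_nat m) - cis 0 ^ m / (\<i> * of_nat m))) {0..2*pi}"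
  proof (rule fundamental_theorem_of_calculus)
    fix t :: real
    have "((\<lambda>t. exp (\<i> * of_nat m * of_real t) / (\<i> * of_nat m)) has_vector_derivative exp (\<i> * of_nat m * of_real t)) (at t within {0..2*pi})"
      using assms by (intro has_vector_derivative_real_field[where f = "\<lambda>z. exp (\<i> * of_nat m * z) / (\<i> * of_nat m)"])
        (auto intro!: derivative_eq_intros)
    then show "((\<lambda>t. cis t ^ m / (\<i> * of_nat m)) has_vector_derivative cis t ^ m) (at t within {0..2*pi})"
      by (simp add: cis_conv_exp exp_of_nat_mult[symmetric] mult_ac)
  qed simp
  then show ?thesis by (simp add: DeMoivre)
qed

text \<open>
  The hypothesis of Weyl's criterion. It is stated for positive exponents only, as the sums with
  negative exponents are their complex conjugates.
\<close>
locale Weyl_sequence =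
  fixes Z :: "nat \<Rightarrow> complex multiset"
  assumes nonzero: "\<And>N. 0 \<notin># Z N"
    and nonempty: "eventually (\<lambda>N. Z N \<noteq> {#}) sequentially"
    and Weyl_sums: "\<And>m. m > 0 \<Longrightarrow> (\<lambda>N. circle_mean (Z N) (\<lambda>z. z ^ m)) \<longlonglongrightarrow> 0"
begin

lemma averages_cong:
  assumes f: "averages_to_integral Z f" and fg: "\<And>z. cmod z = 1 \<Longrightarrow> f z = g z"
  shows "averages_to_integral Z g"
proof -
  have "circle_mean (Z N) f = circle_mean (Z N) g" for N
    using nonzero fg by (rule circle_mean_cong)
  then show ?thesis
    using f by (simp add: averages_to_integral_def fg)
qed

lemma averages_const: "averages_to_integral Z (\<lambda>z. c)"
proof -
  have "(\<lambda>N. circle_mean (Z N) (\<lambda>z. c)) \<longlonglongrightarrow> c"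
    by (rule tendsto_eventually, use nonempty in eventually_elim) (rule circle_mean_const)
  moreover have "((\<lambda>t. c) has_integral of_real (2 * pi) * c) {0..2*pi}"
    using has_integral_const_real[of c 0 "2*pi"] by (simp add: scaleR_conv_of_real)
  ultimately show ?thesis
    unfolding averages_to_integral_def by blast
qed

lemma averages_power: "averages_to_integral Z (\<lambda>z. z ^ m)"
proof (cases "m = 0")
  case True
  then show ?thesis using averages_const by simp
next
  case False
  then show ?thesis
    unfolding averages_to_integral_def
    using Weyl_sums has_integral_cis_power by (intro exI[of _ 0]) auto
qed

lemma averages_cnj_power: "averages_to_integral Z (\<lambda>z. cnj z ^ m)"
proof -
  obtain L where L: "(\<lambda>N. circle_mean (Z N) (\<lambda>z. z ^ m)) \<longlonglongrightarrow> L"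
      "((\<lambda>t. cis t ^ m) has_integral of_real (2 * pi) * L) {0..2*pi}"
    using averages_power unfolding averages_to_integral_def by blast
  have cnj_mset: "cnj (\<Sum>z\<in>#A. f z) = (\<Sum>z\<in>#A. cnj (f z))" for A :: "complex multiset" and f
    by (induction A) auto
  have "circle_mean A (\<lambda>z. cnj z ^ m) = cnj (circle_mean A (\<lambda>z. z ^ m))" for A
    by (simp add: circle_mean_def cnj_mset)
  moreover have "((\<lambda>t. cnj (cis t) ^ m) has_integral of_real (2 * pi) * cnj L) {0..2*pi}"
    using has_integral_cnj[of "\<lambda>t. cis t ^ m" "of_real (2 * pi) * L" "{0..2*pi}"] L(2) by (simp add: o_def)
  ultimately show ?thesis
    using tendsto_cnj[OF L(1)] unfolding averages_to_integral_def by auto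
qed

lemma averages_monomial: "averages_to_integral Z (\<lambda>z. z ^ k * cnj z ^ n)"
proof -
  have one: "z * cnj z = 1" if "cmod z = 1" for z
    using complex_norm_square[of z] that by simp
  show ?thesis
  proof (cases "n \<le> k")
    case True
    have "z ^ (k - n) = z ^ k * cnj z ^ n" if "cmod z = 1" for z
    proof -
      have "z ^ k = z ^ (k - n) * z ^ n" using True by (simp flip: power_add)
      then have "z ^ k * cnj z ^ n = z ^ (k - n) * (z * cnj z) ^ n" by (simp add: power_mult_distrib)
      then show ?thesis using one[OF that] by simp
    qed
    with averages_power[of "k - n"] show ?thesis by (rule averages_cong)
  next
    case False
    have "cnj z ^ (n - k) = z ^ k * cnj z ^ n" if "cmod z = 1" for z
    proof -
      have "cnj z ^ n = cnj z ^ k * cnj z ^ (n - k)" using False by (simp flip: power_add)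
      then have "z ^ k * cnj z ^ n = (z * cnj z) ^ k * cnj z ^ (n - k)" by (simp add: power_mult_distrib)
      then show ?thesis using one[OF that] by simp
    qed
    with averages_cnj_power[of "n - k"] show ?thesis by (rule averages_cong)
  qed
qed

text \<open>
  A real polynomial in \<open>Re z\<close> and \<open>Im z\<close> is a trigonometric polynomial on the unit circle. Clearing the
  denominator by a power of \<open>z\<close> expresses this with ordinary polynomials, which are closed under the
  operations that generate the real polynomial functions.
\<close>
lemma real_polynomial_function_on_circle:
  assumes "real_polynomial_function (h :: complex \<Rightarrow> real)"
  shows "\<exists>q n. \<forall>z. cmod z = 1 \<longrightarrow> of_real (h z) * z ^ n = poly q z"
  using assms
proof (induction rule: real_polynomial_function.induct)
  case (linear f)
  interpret bounded_linear f by fact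
  \<comment> \<open>The coefficients are chosen such that \<open>f z = \<alpha> * z + \<beta> * cnj z\<close>.\<close>
  define \<alpha> \<beta> where "\<alpha> = (of_real (f 1) - \<i> * of_real (f \<i>)) / 2"
    and "\<beta> = (of_real (f 1) + \<i> * of_real (f \<i>)) / 2"
  have "of_real (f z) * z ^ 1 = poly [:\<beta>, 0, \<alpha>:] z" if "cmod z = 1" for z
  proof -
    have "z = Re z *\<^sub>R 1 + Im z *\<^sub>R \<i>" by (simp add: complex_eq_iff)
    then have "f z = Re z * f 1 + Im z * f \<i>"
      by (metis add scaleR real_scaleR_def)
    then have fz: "of_real (f z) = \<alpha> * z + \<beta> * cnj z"
      by (simp add: \<alpha>_def \<beta>_def complex_eq_iff field_simps)
    have "z * cnj z = 1"
      using complex_norm_square[of z] that by simp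
    then have "\<beta> * cnj z * z = \<beta>" by (simp add: mult_ac)
    then show ?thesis unfolding fz by (simp add: algebra_simps)
  qed
  then show ?case by blast
next
  case (const c)
  have "\<forall>z. cmod z = 1 \<longrightarrow> of_real c * z ^ 0 = poly [:of_real c:] z" by simp
  then show ?case by blast
next
  case (add f g)
  then obtain p m q n where
    pq: "\<And>z. cmod z = 1 \<Longrightarrow> of_real (f z) * z ^ m = poly p z"
    "\<And>z. cmod z = 1 \<Longrightarrow> of_real (g z) * z ^ n = poly q z" by blast
  have "of_real (f z + g z) * z ^ (m + n) = poly (p * monom 1 n + q * monom 1 m) z"
    if "cmod z = 1" for z
  proof -
    have "of_real (f z + g z) * z ^ (m + n)
        = of_real (f z) * z ^ m * z ^ n + of_real (g z) * z ^ n * z ^ m"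
      by (simp add: power_add algebra_simps)
    then show ?thesis
      unfolding pq[OF that] by (simp add: poly_monom)
  qed
  then show ?case by blast
next
  case (mult f g)
  then obtain p m q n where
    pq: "\<And>z. cmod z = 1 \<Longrightarrow> of_real (f z) * z ^ m = poly p z"
    "\<And>z. cmod z = 1 \<Longrightarrow> of_real (g z) * z ^ n = poly q z" by blast
  have "of_real (f z * g z) * z ^ (m + n) = poly (p * q) z" if "cmod z = 1" for z
  proof -
    have "of_real (f z * g z) * z ^ (m + n) = of_real (f z) * z ^ m * (of_real (g z) * z ^ n)"
      by (simp add: power_add mult_ac)
    then show ?thesis
      unfolding pq[OF that] by simp
  qed
  then show ?case by blast
qed

text \<open>
  On the circle \<open>cnj z\<close> is the inverse of \<open>z\<close>, so a real polynomial function is a linear combination of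
  monomials \<open>z ^ k * cnj z ^ n\<close>.
\<close>
lemma averages_real_polynomial_function:
  assumes "real_polynomial_function h"
  shows "averages_to_integral Z (\<lambda>z. of_real (h z))"
proof -
  obtain q n where q: "\<And>z. cmod z = 1 \<Longrightarrow> of_real (h z) * z ^ n = poly q z"
    using real_polynomial_function_on_circle[OF assms] by blast
  have "averages_to_integral Z (\<lambda>z. \<Sum>k\<le>degree q. coeff q k * (z ^ k * cnj z ^ n))"
    by (intro averages_sum averages_cmult averages_monomial averages_const) simp
  then show ?thesis
  proof (rule averages_cong)
    fix z :: complex
    assume z: "cmod z = 1"
    have "(\<Sum>k\<le>degree q. coeff q k * (z ^ k * cnj z ^ n)) = poly q z * cnj z ^ n"
      by (simp add: poly_altdef sum_distrib_left mult_ac)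
    also have "\<dots> = of_real (h z) * (z * cnj z) ^ n"
      unfolding q[OF z, symmetric] by (simp add: power_mult_distrib)
    finally show "(\<Sum>k\<le>degree q. coeff q k * (z ^ k * cnj z ^ n)) = of_real (h z)"
      using complex_norm_square[of z] z by simp
  qed
qed

lemma circle_mean_of_real: "circle_mean A (\<lambda>z. complex_of_real (g z)) = of_real (circle_mean A g)"
proof -
  have "(\<Sum>z\<in>#A. complex_of_real (f z)) = of_real (\<Sum>z\<in>#A. f z)" for f :: "complex \<Rightarrow> real"
    by (induction A) auto
  then show ?thesis by (simp add: circle_mean_def)
qed

lemma circle_mean_mono:
  fixes f g :: "complex \<Rightarrow> real"
  assumes "\<And>z. z \<in># A \<Longrightarrow> f (sgn z) \<le> g (sgn z)"
  shows "circle_mean A f \<le> circle_mean A g"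
  unfolding circle_mean_def using assms by (intro divide_right_mono sum_mset_mono) auto

text \<open>
  By the Stone--Weierstrass theorem the passage from polynomials to continuous functions costs an
  arbitrarily small uniform error, both in the means and in the integral.
\<close>
lemma circle_mean_tendsto_integral:
  assumes cont: "continuous_on (sphere 0 1) g"
  shows "(\<lambda>N. circle_mean (Z N) g) \<longlonglongrightarrow> integral {0..2*pi} (\<lambda>t. g (cis t)) / (2 * pi)"
proof (rule tendstoI)
  fix e :: real assume "0 < e"
  define e' where "e' = e / 3"
  have "0 < e'" using \<open>0 < e\<close> by (simp add: e'_def)
  obtain h where h: "real_polynomial_function h" and gh: "\<And>z. cmod z = 1 \<Longrightarrow> \<bar>g z - h z\<bar> < e'"
    using Stone_Weierstrass_real_polynomial_function[OF _ cont \<open>0 < e'\<close>] by auto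
  obtain L where L: "(\<lambda>N. circle_mean (Z N) (\<lambda>z. complex_of_real (h z))) \<longlonglongrightarrow> L"
      "((\<lambda>t. complex_of_real (h (cis t))) has_integral of_real (2 * pi) * L) {0..2*pi}"
    using averages_real_polynomial_function[OF h] unfolding averages_to_integral_def by blast
  have hL: "(\<lambda>N. circle_mean (Z N) h) \<longlonglongrightarrow> Re L"
    using tendsto_Re[OF L(1)] by (simp add: circle_mean_of_real)
  have hI: "((\<lambda>t. h (cis t)) has_integral 2 * pi * Re L) {0..2*pi}"
    using has_integral_linear[OF L(2) bounded_linear_Re] by (simp add: o_def)
  have "continuous_on {0..2*pi} (\<lambda>t. g (cis t))"
    by (rule continuous_on_compose2[OF cont]) (auto intro!: continuous_intros)
  then have gI: "((\<lambda>t. g (cis t)) has_integral integral {0..2*pi} (\<lambda>t. g (cis t))) {0..2*pi}"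
    by (intro integrable_integral integrable_continuous_interval)
  have "norm (integral {0..2*pi} (\<lambda>t. g (cis t)) - 2 * pi * Re L) \<le> e' * measure lborel (cbox 0 (2*pi))"
  proof (rule has_integral_bound)
    show "((\<lambda>t. g (cis t) - h (cis t)) has_integral integral {0..2*pi} (\<lambda>t. g (cis t)) - 2 * pi * Re L) (cbox 0 (2*pi))"
      using has_integral_diff[OF gI hI] by simp
  qed (use gh less_imp_le \<open>0 < e'\<close> in \<open>auto simp: real_norm_def intro: less_imp_le\<close>)
  then have IL: "\<bar>integral {0..2*pi} (\<lambda>t. g (cis t)) / (2 * pi) - Re L\<bar> \<le> e'"
    by (simp add: abs_le_iff field_simps)
  have gh_mean: "\<bar>circle_mean (Z N) g - circle_mean (Z N) h\<bar> \<le> e'" if "Z N \<noteq> {#}" for N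
  proof -
    have sgn: "cmod (sgn z) = 1" if "z \<in># Z N" for z
      using nonzero[of N] that by (auto simp: norm_sgn)
    have "circle_mean (Z N) g \<le> circle_mean (Z N) (\<lambda>z. h z + e')"
      "circle_mean (Z N) h \<le> circle_mean (Z N) (\<lambda>z. g z + e')"
      using gh[OF sgn] by (intro circle_mean_mono; fastforce simp: abs_less_iff)+
    then show ?thesis
      unfolding circle_mean_add circle_mean_const[OF that] by linarith
  qed
  show "eventually (\<lambda>N. dist (circle_mean (Z N) g) (integral {0..2*pi} (\<lambda>t. g (cis t)) / (2 * pi)) < e) sequentially"
    using nonempty tendstoD[OF hL \<open>0 < e'\<close>]
  proof eventually_elim
    case (elim N)
    then show ?case
      using gh_mean[of N] IL unfolding dist_real_def e'_def by linarith
  qed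
qed

lemma sgn_eq_cis_Arg2pi: "z \<noteq> 0 \<Longrightarrow> sgn z = cis (Arg2pi z)"
  using Arg2pi_eq[of z] by (simp add: sgn_eq cis_conv_exp field_simps)

text \<open>
  The endpoints \<open>t = 0\<close> and \<open>t = 2 * pi\<close> are excluded because they give the same point of the circle,
  which may lie on the arc through only one of them.
\<close>
lemma cis_mem_arc_iff:
  assumes "0 \<le> \<theta>" "\<phi> \<le> 2 * pi" "0 < t" "t < 2 * pi"
  shows "cis t \<in> cis ` {\<theta>..\<phi>} \<longleftrightarrow> t \<in> {\<theta>..\<phi>}"
proof
  assume "cis t \<in> cis ` {\<theta>..\<phi>}"
  then obtain s where s: "s \<in> {\<theta>..\<phi>}" "cis t = cis s" by auto
  have t: "Arg2pi (cis t) = t"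
    by (rule Arg2pi_unique[of 1]) (use assms in \<open>auto simp: cis_conv_exp\<close>)
  show "t \<in> {\<theta>..\<phi>}"
  proof (cases "s = 2 * pi")
    case True
    then show ?thesis using s t \<open>0 < t\<close> by (simp add: Arg2pi_unique[of 1 0 1])
  next
    case False
    have "Arg2pi (cis s) = s"
      by (rule Arg2pi_unique[of 1]) (use assms s False in \<open>auto simp: cis_conv_exp\<close>)
    then have "t = s" using s(2) t by metis
    then show ?thesis using s(1) by simp
  qed
qed auto

text \<open>
  The indicator function of the closed arc is the decreasing limit of continuous functions \<open>g n\<close>, whose
  integrals tend to the length of the arc by dominated convergence. So the proportion of points on the
  arc is at most a mean whose limit is close to the normalised length.
\<close>
lemma sector_upper_bound:
  assumes "0 \<le> \<theta>" "\<theta> \<le> \<phi>" "\<phi> \<le> 2 * pi" and "0 < e"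
  shows "eventually (\<lambda>N. real (size {#z \<in># Z N. \<theta> \<le> Arg2pi z \<and> Arg2pi z < \<phi>#}) / size (Z N)
    < (\<phi> - \<theta>) / (2 * pi) + e) sequentially"
proof -
  define A where "A = cis ` {\<theta>..\<phi>}"
  have A: "closed A" "A \<noteq> {}"
    using assms by (simp_all add: A_def compact_imp_closed compact_continuous_image continuous_on_cis)
  define g where "g n z = max 0 (1 - real n * infdist z A)" for n z
  have cont: "continuous_on S (g n)" for n S
    unfolding g_def by (intro continuous_intros)
  have lim: "(\<lambda>n. g n z) \<longlonglongrightarrow> (if z \<in> A then 1 else 0)" for z
  proof (cases "z \<in> A")
    case False
    then have "0 < infdist z A"
      using in_closed_iff_infdist_zero[OF A] infdist_nonneg[of z A] by force
    then have "filterlim (\<lambda>n. real n * infdist z A) at_top sequentially"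
      by (intro filterlim_at_top_mult_tendsto_pos[OF tendsto_const _ filterlim_real_sequentially])
    then have "eventually (\<lambda>n. 1 \<le> real n * infdist z A) sequentially"
      by (simp add: filterlim_at_top)
    then have "eventually (\<lambda>n. g n z = 0) sequentially"
      by eventually_elim (simp add: g_def)
    then show ?thesis using False by (simp add: tendsto_eventually)
  qed (simp add: g_def)
  have "((\<lambda>t. if t \<in> {\<theta>..\<phi>} then 1 else 0) has_integral (\<phi> - \<theta>)) {0..2*pi}"
    using has_integral_restrict[of "{\<theta>..\<phi>}" "{0..2*pi}" "\<lambda>_. 1 :: real"] has_integral_const_real[of "1::real" \<theta> \<phi>] assms
    by simp
  then have int: "((\<lambda>t. if cis t \<in> A then 1 else 0) has_integral (\<phi> - \<theta>)) {0..2*pi}"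
    by (rule has_integral_spike_finite[of "{0, 2*pi}", rotated 2])
      (use cis_mem_arc_iff[OF assms(1,3)] in \<open>auto simp: A_def less_le\<close>)
  have g_bound: "0 \<le> g n z" "g n z \<le> 1" for n z
    by (auto simp: g_def infdist_nonneg)
  have "(\<lambda>n. integral {0..2*pi} (\<lambda>t. g n (cis t))) \<longlonglongrightarrow> integral {0..2*pi} (\<lambda>t. if cis t \<in> A then 1 else 0)"
  proof (rule dominated_convergence(2)[where h = "\<lambda>_. 1"])
    fix n
    have "continuous_on {0..2*pi} (\<lambda>t. g n (cis t))"
      by (rule continuous_on_compose2[OF cont[of UNIV]]) (auto intro!: continuous_intros)
    then show "(\<lambda>t. g n (cis t)) integrable_on {0..2*pi}"
      by (rule integrable_continuous_interval)
  qed (use g_bound lim in auto)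
  then have "(\<lambda>n. integral {0..2*pi} (\<lambda>t. g n (cis t)) / (2*pi)) \<longlonglongrightarrow> (\<phi> - \<theta>) / (2 * pi)"
    unfolding integral_unique[OF int] by (intro tendsto_divide) auto
  from tendstoD[OF this \<open>0 < e\<close>, THEN eventually_happens]
  obtain n where "dist (integral {0..2*pi} (\<lambda>t. g n (cis t)) / (2*pi)) ((\<phi> - \<theta>) / (2 * pi)) < e"
    by auto
  then have "integral {0..2*pi} (\<lambda>t. g n (cis t)) / (2*pi) < (\<phi> - \<theta>) / (2 * pi) + e"
    unfolding dist_real_def by linarith
  from order_tendstoD(2)[OF circle_mean_tendsto_integral[OF cont] this]
  have "eventually (\<lambda>N. circle_mean (Z N) (g n) < (\<phi> - \<theta>) / (2 * pi) + e) sequentially" .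
  then show ?thesis
  proof eventually_elim
    case (elim N)
    have size: "real (size {#z \<in># B. P z#}) = (\<Sum>z\<in>#B. if P z then 1 else 0)" for B :: "complex multiset" and P
      by (induction B) auto
    have "(\<Sum>z\<in>#Z N. if \<theta> \<le> Arg2pi z \<and> Arg2pi z < \<phi> then 1 else 0) \<le> (\<Sum>z\<in>#Z N. g n (sgn z))"
    proof (rule sum_mset_mono)
      fix z assume "z \<in># Z N"
      then have "sgn z = cis (Arg2pi z)" using nonzero sgn_eq_cis_Arg2pi by metis
      then show "(if \<theta> \<le> Arg2pi z \<and> Arg2pi z < \<phi> then 1 else 0) \<le> g n (sgn z)"
        using g_bound by (auto simp: g_def A_def)
    qed
    then have "real (size {#z \<in># Z N. \<theta> \<le> Arg2pi z \<and> Arg2pi z < \<phi>#}) / size (Z N) \<le> circle_mean (Z N) (g n)"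
      unfolding circle_mean_def size by (intro divide_right_mono) auto
    then show ?case using elim by linarith
  qed
qed

text \<open>
  The lower bound comes for free: the sector and its two complementary sectors together contain all
  points, and their normalised lengths add up to one, so the upper bounds for the complementary
  sectors bound the proportion in the sector itself from below.
\<close>
lemma sector_proportion_tendsto:
  assumes "0 \<le> \<theta>" "\<theta> < \<phi>" "\<phi> \<le> 2 * pi"
  shows "(\<lambda>N. real (size {#z \<in># Z N. \<theta> \<le> Arg2pi z \<and> Arg2pi z < \<phi>#}) / size (Z N))
    \<longlonglongrightarrow> (\<phi> - \<theta>) / (2 * pi)"
proof (rule tendstoI)
  fix e :: real assume "0 < e"
  let ?c = "\<lambda>N \<theta> \<phi>. real (size {#z \<in># Z N. \<theta> \<le> Arg2pi z \<and> Arg2pi z < \<phi>#}) / size (Z N)"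
  have e: "0 < e / 2" using \<open>0 < e\<close> by simp
  have lengths: "(\<theta> - 0) / (2*pi) + (\<phi> - \<theta>) / (2*pi) + (2*pi - \<phi>) / (2*pi) = 1"
    by (simp add: field_simps)
  have "eventually (\<lambda>N. ?c N 0 \<theta> < (\<theta> - 0) / (2*pi) + e/2) sequentially"
    "eventually (\<lambda>N. ?c N \<theta> \<phi> < (\<phi> - \<theta>) / (2*pi) + e/2) sequentially"
    "eventually (\<lambda>N. ?c N \<phi> (2*pi) < (2*pi - \<phi>) / (2*pi) + e/2) sequentially"
    using assms e by (intro sector_upper_bound; simp)+
  then show "eventually (\<lambda>N. dist (?c N \<theta> \<phi>) ((\<phi> - \<theta>) / (2 * pi)) < e) sequentially"
    using nonempty
  proof eventually_elim
    case (elim N)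
    have "size {#z \<in># B. 0 \<le> Arg2pi z \<and> Arg2pi z < \<theta>#}
        + size {#z \<in># B. \<theta> \<le> Arg2pi z \<and> Arg2pi z < \<phi>#}
        + size {#z \<in># B. \<phi> \<le> Arg2pi z \<and> Arg2pi z < 2*pi#} = size B" for B
      using assms by (induction B) (auto simp: Arg2pi_ge_0 Arg2pi_lt_2pi)
    from arg_cong[OF this[of "Z N"], of "\<lambda>n. real n / size (Z N)"]
    have "?c N 0 \<theta> + ?c N \<theta> \<phi> + ?c N \<phi> (2*pi) = 1"
      using elim by (simp add: add_divide_distrib)
    then show ?case
      using elim lengths unfolding dist_real_def by linarith
  qed
qed

end

section \<open>Coefficients of subexponential growth\<close>

text \<open>
  Taking logarithms, \<open>n N * ln R\<close> is at most \<open>2 * \<epsilon> * N\<close> for every \<open>\<epsilon> > 0\<close> and all large \<open>N\<close>.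
\<close>
lemma proportion_tendsto_0:
  fixes n :: "nat \<Rightarrow> nat" and c S :: "nat \<Rightarrow> real"
  assumes "1 < R" and bound: "\<And>N. c N * R ^ n N \<le> S N"
    and S: "\<And>\<epsilon>. 0 < \<epsilon> \<Longrightarrow> eventually (\<lambda>N. S N \<le> exp (\<epsilon> * real N)) sequentially"
    and c: "\<And>\<epsilon>. 0 < \<epsilon> \<Longrightarrow> eventually (\<lambda>N. exp (- \<epsilon> * real N) \<le> c N) sequentially"
  shows "(\<lambda>N. real (n N) / real N) \<longlonglongrightarrow> 0"
proof (rule tendstoI)
  fix e :: real assume "0 < e"
  \<comment> \<open>The two exponential errors then contribute \<open>2 * \<epsilon> / ln R = e / 2\<close>, which leaves room for a strict
     inequality.\<close>
  define \<epsilon> where "\<epsilon> = e * ln R / 4"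
  have "0 < \<epsilon>" using \<open>0 < e\<close> \<open>1 < R\<close> by (simp add: \<epsilon>_def)
  show "eventually (\<lambda>N. dist (real (n N) / real N) 0 < e) sequentially"
    using S[OF \<open>0 < \<epsilon>\<close>] c[OF \<open>0 < \<epsilon>\<close>] eventually_gt_at_top[of 0]
  proof eventually_elim
    case (elim N)
    have "exp (- \<epsilon> * real N) * R ^ n N \<le> c N * R ^ n N"
      using elim \<open>1 < R\<close> by (intro mult_right_mono) auto
    also have "\<dots> \<le> exp (\<epsilon> * real N)"
      using bound[of N] elim by linarith
    finally have "R ^ n N \<le> exp (2 * \<epsilon> * real N)"
      by (simp add: exp_minus field_simps flip: exp_add)
    then have "ln (R ^ n N) \<le> 2 * \<epsilon> * real N"
      using \<open>1 < R\<close> by (subst (asm) ln_le_cancel_iff[symmetric]) auto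
    then have "real (n N) * ln R \<le> e / 2 * real N * ln R"
      using \<open>1 < R\<close> by (simp add: ln_realpow \<epsilon>_def mult_ac)
    then have "real (n N) \<le> e / 2 * real N"
      using \<open>1 < R\<close> by simp
    also have "\<dots> < e * real N"
      using \<open>0 < e\<close> elim by simp
    finally show ?case
      using elim by (simp add: field_simps)
  qed
qed

text \<open>
  The two growth conditions say that \<open>|a k|\<close> to the power \<open>1 / k\<close> tends to \<open>1\<close>. They are stated as separate
  one-sided bounds since these arise from different hypotheses on random coefficients.
\<close>
locale subexponential_coeffs =
  fixes a :: "nat \<Rightarrow> complex"
  assumes nonzero_coeff: "\<And>k. a k \<noteq> 0"
    and upper: "\<And>\<epsilon>. 0 < \<epsilon> \<Longrightarrow> eventually (\<lambda>k. cmod (a k) \<le> exp (\<epsilon> * real k)) sequentially"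
    and lower: "\<And>\<epsilon>. 0 < \<epsilon> \<Longrightarrow> eventually (\<lambda>k. exp (- \<epsilon> * real k) \<le> cmod (a k)) sequentially"
begin

definition P :: "nat \<Rightarrow> complex poly" where
  "P N = (\<Sum>k\<le>N. monom (a k) k)"

lemma coeff_P: "coeff (P N) k = (if k \<le> N then a k else 0)"
  by (simp add: P_def coeff_sum)

lemma degree_P: "degree (P N) = N"
  by (intro antisym degree_le le_degree) (auto simp: coeff_P nonzero_coeff)

lemma size_proots_P: "size (proots (P N)) = N"
  by (simp add: size_proots_complex degree_P)

lemma zero_not_root: "0 \<notin># proots (P N)"
proof -
  have "P N \<noteq> 0" using coeff_P[of N 0] nonzero_coeff[of 0] by auto
  then show ?thesis by (simp add: poly_0_coeff_0 coeff_P nonzero_coeff)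
qed

lemma coeff_bound:
  assumes "0 < \<epsilon>"
  obtains C where "1 \<le> C" "\<And>k. cmod (a k) \<le> C * exp (\<epsilon> * real k)"
proof -
  obtain K where K: "\<And>k. K \<le> k \<Longrightarrow> cmod (a k) \<le> exp (\<epsilon> * real k)"
    using upper[OF assms] by (auto simp: eventually_sequentially)
  define C where "C = 1 + (\<Sum>k<K. cmod (a k))"
  have C: "1 \<le> C" by (simp add: C_def sum_nonneg)
  have "cmod (a k) \<le> C * exp (\<epsilon> * real k)" for k
  proof (cases "k < K")
    case True
    then have "cmod (a k) \<le> C * 1"
      using member_le_sum[of k "{..<K}" "\<lambda>k. cmod (a k)"] by (simp add: C_def)
    also have "\<dots> \<le> C * exp (\<epsilon> * real k)"
      using C assms by (intro mult_left_mono) auto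
    finally show ?thesis .
  next
    case False
    then have "cmod (a k) \<le> exp (\<epsilon> * real k)" using K by simp
    also have "\<dots> \<le> C * exp (\<epsilon> * real k)" using C by simp
    finally show ?thesis .
  qed
  with C show ?thesis by (rule that)
qed

lemma sum_coeffs_subexponential:
  assumes "0 < \<epsilon>"
  shows "eventually (\<lambda>N. (\<Sum>k\<le>N. cmod (a k)) \<le> exp (\<epsilon> * real N)) sequentially"
proof -
  have "0 < \<epsilon> / 2" using assms by simp
  then obtain C where C: "1 \<le> C" "\<And>k. cmod (a k) \<le> C * exp (\<epsilon> / 2 * real k)"
    using coeff_bound by blast
  have "eventually (\<lambda>N. (real N + 1) * (C * exp (\<epsilon> / 2 * real N)) \<le> exp (\<epsilon> * real N)) sequentially"
    using assms C(1) by real_asymp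
  then show ?thesis
  proof eventually_elim
    case (elim N)
    have "(\<Sum>k\<le>N. cmod (a k)) \<le> (\<Sum>k\<le>N. C * exp (\<epsilon> / 2 * real N))"
    proof (rule sum_mono)
      fix k assume "k \<in> {..N}"
      then have "C * exp (\<epsilon> / 2 * real k) \<le> C * exp (\<epsilon> / 2 * real N)"
        using C(1) assms by (intro mult_left_mono) auto
      then show "cmod (a k) \<le> C * exp (\<epsilon> / 2 * real N)"
        using C(2)[of k] by linarith
    qed
    also have "\<dots> = (real N + 1) * (C * exp (\<epsilon> / 2 * real N))"
      by simp
    also note elim
    finally show ?case .
  qed
qed

text \<open>
  Large zeros are controlled by the leading coefficient \<open>a N\<close> and small zeros by the constant
  coefficient \<open>a 0\<close>; neither is exponentially small compared with the sum of all \<open>|a k|\<close>.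
\<close>
lemma few_zeros_off_annulus:
  assumes "1 < R"
  shows "(\<lambda>N. real (size {#z \<in># proots (P N). R < cmod z#}) / real N) \<longlonglongrightarrow> 0"
    and "(\<lambda>N. real (size {#z \<in># proots (P N). R < 1 / cmod z#}) / real N) \<longlonglongrightarrow> 0"
proof -
  have S: "(\<Sum>k\<le>degree (P N). cmod (coeff (P N) k)) = (\<Sum>k\<le>N. cmod (a k))" for N
    by (simp add: degree_P coeff_P)
  have bounds: "cmod (a N) * R ^ size {#z \<in># proots (P N). R < cmod z#} \<le> (\<Sum>k\<le>N. cmod (a k))"
    "cmod (a 0) * R ^ size {#z \<in># proots (P N). R < 1 / cmod z#} \<le> (\<Sum>k\<le>N. cmod (a k))" for N
    using number_of_zeros_off_annulus[of "P N" R] assms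
    unfolding S by (simp_all add: coeff_P degree_P nonzero_coeff)
  show "(\<lambda>N. real (size {#z \<in># proots (P N). R < cmod z#}) / real N) \<longlonglongrightarrow> 0"
    by (rule proportion_tendsto_0[OF assms bounds(1) sum_coeffs_subexponential lower])
  have c: "eventually (\<lambda>N. exp (- \<epsilon> * real N) \<le> cmod (a 0)) sequentially" if "0 < \<epsilon>" for \<epsilon>
  proof -
    have "0 < cmod (a 0)" using nonzero_coeff by simp
    then show ?thesis using that by real_asymp
  qed
  show "(\<lambda>N. real (size {#z \<in># proots (P N). R < 1 / cmod z#}) / real N) \<longlonglongrightarrow> 0"
    by (rule proportion_tendsto_0[OF assms bounds(2) sum_coeffs_subexponential c])
qed

lemma annulus_proportion_tendsto_1:
  assumes "1 < R"
  shows "(\<lambda>N. real (size {#z \<in># proots (P N). 1 / R \<le> cmod z \<and> cmod z \<le> R#}) / real N) \<longlonglongrightarrow> 1"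
proof -
  have split: "size {#z \<in># A. 1 / R \<le> cmod z \<and> cmod z \<le> R#} + size {#z \<in># A. R < cmod z#}
      + size {#z \<in># A. R < 1 / cmod z#} = size A" if "0 \<notin># A" for A
    using that
  proof (induction A)
    case (add z A)
    have z: "R < 1 / cmod z \<longleftrightarrow> cmod z < 1 / R"
      using add.prems assms by (auto simp: field_simps)
    have "\<not> (R < cmod z \<and> cmod z < 1 / R)"
      using assms by (smt (verit) less_divide_eq_1_pos)
    then show ?case using add unfolding filter_mset_add_mset z by auto
  qed simp
  have "(\<lambda>N. 1 - real (size {#z \<in># proots (P N). R < cmod z#}) / real N
      - real (size {#z \<in># proots (P N). R < 1 / cmod z#}) / real N) \<longlonglongrightarrow> 1 - 0 - 0"
    by (intro tendsto_diff tendsto_const few_zeros_off_annulus assms)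
  moreover have "eventually (\<lambda>N. 1 - real (size {#z \<in># proots (P N). R < cmod z#}) / real N
      - real (size {#z \<in># proots (P N). R < 1 / cmod z#}) / real N
      = real (size {#z \<in># proots (P N). 1 / R \<le> cmod z \<and> cmod z \<le> R#}) / real N) sequentially"
    using eventually_gt_at_top[of 0]
  proof eventually_elim
    case (elim N)
    from arg_cong[OF split[OF zero_not_root, of N], of "\<lambda>n. real n / real N"]
    have "real (size {#z \<in># proots (P N). 1 / R \<le> cmod z \<and> cmod z \<le> R#}) / real N
        + real (size {#z \<in># proots (P N). R < cmod z#}) / real N
        + real (size {#z \<in># proots (P N). R < 1 / cmod z#}) / real N = 1"
      using elim by (simp add: size_proots_P add_divide_distrib)
    then show ?case by linarith
  qed
  ultimately show ?thesis by (simp add: tendsto_cong)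
qed

text \<open>
  As \<open>|a k|\<close> is at most \<open>D * B ^ k\<close>, the terms of positive degree add up to at most
  \<open>2 * D * B * |z|\<close> when \<open>B * |z|\<close> is at most \<open>1 / 2\<close>, and at a zero they have to cancel \<open>a 0\<close>. The
  bound does not depend on \<open>N\<close>.
\<close>
lemma roots_bounded_away_from_0:
  obtains C where "\<And>N z. z \<in># proots (P N) \<Longrightarrow> 1 / cmod z \<le> C"
proof -
  obtain D where D: "1 \<le> D" "\<And>k. cmod (a k) \<le> D * exp (1 * real k)"
    using coeff_bound[of 1] by auto
  define B :: real where "B = exp 1"
  have B: "0 < B" by (simp add: B_def)
  have aB: "cmod (a k) \<le> D * B ^ k" for k
    using D(2)[of k] by (simp add: B_def exp_of_nat_mult[symmetric] mult.commute)
  have "1 / cmod z \<le> max (2 * B) (2 * D * B / cmod (a 0))" if "z \<in># proots (P N)" for N z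
  proof (cases "B * cmod z \<le> 1 / 2")
    case False
    moreover have "z \<noteq> 0" using zero_not_root[of N] that by auto
    ultimately have "1 / cmod z \<le> 2 * B" by (simp add: field_simps)
    then show ?thesis by simp
  next
    case True
    have z: "z \<noteq> 0" using zero_not_root[of N] that by auto
    have "poly (P N) z = 0"
      using that by (cases "P N = 0") auto
    then have root: "(\<Sum>k\<le>N. a k * z ^ k) = 0"
      by (simp add: poly_altdef degree_P coeff_P)
    have "cmod (\<Sum>k<N. a (Suc k) * z ^ k) \<le> (\<Sum>k<N. D * B * (B * cmod z) ^ k)"
    proof (rule sum_norm_le)
      fix k
      have "cmod (a (Suc k) * z ^ k) \<le> D * B ^ Suc k * cmod z ^ k"
        using aB[of "Suc k"] by (simp add: norm_mult norm_power mult_right_mono)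
      then show "cmod (a (Suc k) * z ^ k) \<le> D * B * (B * cmod z) ^ k"
        by (simp add: power_mult_distrib mult_ac)
    qed
    also have "\<dots> = D * B * (\<Sum>k<N. (B * cmod z) ^ k)"
      by (simp add: sum_distrib_left)
    also have "(\<Sum>k<N. (B * cmod z) ^ k) \<le> (\<Sum>k<N. (1 / 2) ^ k)"
      using B True by (intro sum_mono power_mono) auto
    also have "(\<Sum>k<N. (1 / 2 :: real) ^ k) \<le> 2"
      by (simp add: geometric_sum)
    finally have tail: "cmod (\<Sum>k<N. a (Suc k) * z ^ k) \<le> D * B * 2"
      using D(1) B by simp
    have "(\<Sum>k\<le>N. a k * z ^ k) = a 0 + z * (\<Sum>k<N. a (Suc k) * z ^ k)"
      by (simp add: sum.atMost_shift sum_distrib_left mult_ac)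
    then have "cmod (a 0) = cmod z * cmod (\<Sum>k<N. a (Suc k) * z ^ k)"
      using root by (metis add_eq_0_iff norm_minus_cancel norm_mult)
    also have "\<dots> \<le> cmod z * (D * B * 2)"
      by (intro mult_left_mono tail) simp
    finally have "1 / cmod z \<le> 2 * D * B / cmod (a 0)"
      using z nonzero_coeff[of 0] by (simp add: field_simps)
    then show ?thesis by simp
  qed
  then show ?thesis by (rule that)
qed

text \<open>
  All \<open>P N\<close> with \<open>N \<ge> m\<close> share their coefficients up to degree \<open>m\<close>, so the sum does not depend on
  \<open>N\<close> any more.
\<close>
lemma inverse_power_means_tendsto_0:
  assumes "0 < m"
  shows "(\<lambda>N. (\<Sum>z\<in>#proots (P N). inverse z ^ m) / of_nat N) \<longlonglongrightarrow> 0"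
proof -
  define E where "E = (\<Sum>z\<in>#proots (P m). inverse z ^ m)"
  have "(\<lambda>N. E / of_nat N) \<longlonglongrightarrow> 0"
    by (rule lim_const_over_n)
  moreover have "eventually (\<lambda>N. E / of_nat N = (\<Sum>z\<in>#proots (P N). inverse z ^ m) / of_nat N) sequentially"
    using eventually_ge_at_top[of m]
  proof eventually_elim
    case (elim N)
    then have "(\<Sum>z\<in>#proots (P N). inverse z ^ Suc (m - 1)) = (\<Sum>z\<in>#proots (P m). inverse z ^ Suc (m - 1))"
      using assms by (intro inverse_power_sums_eq[where n = m]) (auto simp: coeff_P nonzero_coeff)
    then show ?case using assms by (simp add: E_def)
  qed
  ultimately show ?thesis by (simp add: tendsto_cong)
qed

text \<open>
  The numbers \<open>inverse z ^ m\<close> and \<open>inverse (sgn z) ^ m\<close> have the same direction and differ only in modulus.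
\<close>
lemma inverse_power_diff_sgn:
  assumes "z \<noteq> 0"
  shows "cmod (inverse z ^ m - inverse (sgn z) ^ m) = \<bar>(1 / cmod z) ^ m - 1\<bar>"
proof -
  have "inverse z = inverse (sgn z) * of_real (1 / cmod z)"
    using assms by (simp add: sgn_eq field_simps)
  then have "inverse z ^ m - inverse (sgn z) ^ m = inverse (sgn z) ^ m * of_real ((1 / cmod z) ^ m - 1)"
    by (simp only: power_mult_distrib) (simp add: algebra_simps)
  then show ?thesis
    using assms by (simp only: norm_mult norm_of_real norm_power norm_inverse norm_sgn) simp
qed

text \<open>
  The mean of the \<open>m\<close>-th inverse powers of the zeros tends to \<open>0\<close>. Replacing each zero by its direction
  changes little for the zeros close to the unit circle; the others are too few to matter, since by
  \<open>roots_bounded_away_from_0\<close> each of them contributes a bounded error.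
\<close>
lemma Weyl_sums_tendsto_0:
  assumes "0 < m"
  shows "(\<lambda>N. circle_mean (proots (P N)) (\<lambda>z. z ^ m)) \<longlonglongrightarrow> 0"
proof -
  obtain C where C: "\<And>N z. z \<in># proots (P N) \<Longrightarrow> 1 / cmod z \<le> C"
    using roots_bounded_away_from_0 by blast
  define D where "D = (\<lambda>N. (\<Sum>z\<in>#proots (P N). inverse z ^ m) / of_nat N
      - (\<Sum>z\<in>#proots (P N). inverse (sgn z) ^ m) / of_nat N)"
  have "D \<longlonglongrightarrow> 0"
  proof (rule tendstoI)
    fix e :: real assume "0 < e"
    \<comment> \<open>With this width of the annulus a zero in it changes by at most \<open>R ^ m - 1 = e / 2\<close>.\<close>
    define R where "R = root m (1 + e / 2)"
    have R: "1 < R" "R ^ m = 1 + e / 2"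
      using assms \<open>0 < e\<close> by (auto simp: R_def)
    define \<nu> where "\<nu> N = real (size {#z \<in># proots (P N). 1 / R \<le> cmod z \<and> cmod z \<le> R#}) / real N" for N
    have "\<nu> \<longlonglongrightarrow> 1"
      unfolding \<nu>_def by (rule annulus_proportion_tendsto_1[OF R(1)])
    then have lim: "(\<lambda>N. e / 2 + (C ^ m + 1) * (1 - \<nu> N)) \<longlonglongrightarrow> e / 2 + (C ^ m + 1) * (1 - 1)"
      by (intro tendsto_intros)
    have ev: "eventually (\<lambda>N. e / 2 + (C ^ m + 1) * (1 - \<nu> N) < e) sequentially"
      using \<open>0 < e\<close> by (intro order_tendstoD(2)[OF lim]) simp
    show "eventually (\<lambda>N. dist (D N) 0 < e) sequentially"
      using ev eventually_gt_at_top[of 0]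
    proof eventually_elim
      case (elim N)
      let ?A = "\<lambda>z. 1 / R \<le> cmod z \<and> cmod z \<le> R"
      have diff: "cmod (inverse z ^ m - inverse (sgn z) ^ m) \<le> e / 2 + (if ?A z then 0 else C ^ m + 1)"
        if z: "z \<in># proots (P N)" for z
      proof -
        have "z \<noteq> 0" using z zero_not_root by auto
        define t where "t = 1 / cmod z"
        have "0 \<le> t" "t \<le> C" using C[OF z] by (auto simp: t_def)
        have "\<bar>t ^ m - 1\<bar> \<le> e / 2 + (if ?A z then 0 else C ^ m + 1)"
        proof (cases "?A z")
          case True
          then have "1 / R \<le> t" "t \<le> R"
            using R(1) \<open>z \<noteq> 0\<close> by (auto simp: t_def field_simps)
          then have "(1 / R) ^ m \<le> t ^ m" "t ^ m \<le> R ^ m"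
            using R(1) \<open>0 \<le> t\<close> by (auto intro!: power_mono)
          moreover have "1 - e / 2 \<le> 1 / (1 + e / 2)"
            using \<open>0 < e\<close> by (simp add: field_simps)
          ultimately have "1 - e / 2 \<le> t ^ m" "t ^ m \<le> 1 + e / 2"
            unfolding power_divide R(2) by simp_all
          then have "\<bar>t ^ m - 1\<bar> \<le> e / 2" by linarith
          then show ?thesis using True by simp
        next
          case False
          have "0 \<le> t ^ m" "t ^ m \<le> C ^ m"
            using \<open>0 \<le> t\<close> \<open>t \<le> C\<close> by (auto intro: power_mono)
          then show ?thesis using False \<open>0 < e\<close> by (auto simp: abs_le_iff)
        qed
        then show ?thesis
          unfolding inverse_power_diff_sgn[OF \<open>z \<noteq> 0\<close>] t_def .
      qed
      have norm_sum: "cmod (\<Sum>z\<in>#A. f z) \<le> (\<Sum>z\<in>#A. cmod (f z))" for A :: "complex multiset" and f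
        by (induction A) (auto intro: norm_triangle_le)
      have sum_if: "(\<Sum>z\<in>#A. b + (if Q z then 0 else c)) = b * size A + c * (size A - real (size {#z \<in># A. Q z#}))"
        for A :: "complex multiset" and b c :: real and Q
        by (induction A) (auto simp: algebra_simps)
      have sum_diff: "(\<Sum>z\<in>#A. f z - g z) = (\<Sum>z\<in>#A. f z) - (\<Sum>z\<in>#A. g z)"
        for A :: "complex multiset" and f g :: "complex \<Rightarrow> complex"
        by (induction A) auto
      have "D N = (\<Sum>z\<in>#proots (P N). inverse z ^ m - inverse (sgn z) ^ m) / of_nat N"
        unfolding D_def sum_diff by (simp add: diff_divide_distrib)
      then have "cmod (D N) \<le> (\<Sum>z\<in>#proots (P N). cmod (inverse z ^ m - inverse (sgn z) ^ m)) / N"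
        by (simp add: norm_divide divide_right_mono norm_sum)
      also have "\<dots> \<le> (\<Sum>z\<in>#proots (P N). e / 2 + (if ?A z then 0 else C ^ m + 1)) / N"
        using diff by (intro divide_right_mono sum_mset_mono) auto
      also have "\<dots> = e / 2 + (C ^ m + 1) * (1 - \<nu> N)"
        unfolding sum_if size_proots_P \<nu>_def using elim by (simp add: field_simps)
      finally show ?case using elim by simp
    qed
  qed
  from tendsto_diff[OF inverse_power_means_tendsto_0[OF assms] this]
  have "(\<lambda>N. (\<Sum>z\<in>#proots (P N). inverse (sgn z) ^ m) / of_nat N) \<longlonglongrightarrow> 0"
    by (simp add: D_def)
  moreover have "(\<Sum>z\<in>#A. inverse (sgn z) ^ m) = cnj (\<Sum>z\<in>#A. sgn z ^ m)" if "0 \<notin># A" for A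
    using that
  proof (induction A)
    case (add z A)
    have "inverse (sgn z) = cnj (sgn z)"
      using add.prems complex_norm_square[of "sgn z"] by (intro inverse_unique) (simp add: norm_sgn)
    then show ?case using add by simp
  qed simp
  ultimately have "(\<lambda>N. cnj (circle_mean (proots (P N)) (\<lambda>z. z ^ m))) \<longlonglongrightarrow> 0"
    by (simp add: circle_mean_def size_proots_P zero_not_root)
  then show ?thesis
    using lim_cnj[of _ 0] by fastforce
qed

lemma zeros_cluster: "zeros_cluster_uniformly P"
proof -
  interpret Weyl_sequence "\<lambda>N. proots (P N)"
  proof
    show "eventually (\<lambda>N. proots (P N) \<noteq> {#}) sequentially"
      using eventually_gt_at_top[of 0]
    proof eventually_elim
      case (elim N)
      then show ?case using size_proots_P[of N] by auto
    qed
  qed (use zero_not_root Weyl_sums_tendsto_0 in auto)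
  have "(\<lambda>N. real (zeros_in_annulus (P N) \<rho>) / real N) \<longlonglongrightarrow> 1" if "0 < \<rho>" "\<rho> < 1" for \<rho>
    using annulus_proportion_tendsto_1[of "1 / (1 - \<rho>)"] that by (simp add: zeros_in_annulus_def)
  then show ?thesis
    unfolding zeros_cluster_uniformly_def zeros_in_sector_def
    using sector_proportion_tendsto by (simp add: size_proots_P)
qed

end

section \<open>Almost sure growth of random coefficients\<close>

lemma limsup_root_bound:
  fixes \<mu> :: "nat \<Rightarrow> real"
  assumes "\<And>k. 0 \<le> \<mu> k" and "limsup (\<lambda>k. ereal (\<mu> k powr (1 / real k))) \<le> 1" and "0 < \<epsilon>"
  shows "eventually (\<lambda>k. \<mu> k \<le> exp (\<epsilon> * real k)) sequentially"
proof -
  have "limsup (\<lambda>k. ereal (\<mu> k powr (1 / real k))) < ereal (exp \<epsilon>)"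
    using assms(2) by (rule order.strict_trans1) (use \<open>0 < \<epsilon>\<close> in simp)
  from Limsup_lessD[OF this] show ?thesis
    using eventually_gt_at_top[of 0]
  proof eventually_elim
    case (elim k)
    have "\<mu> k = (\<mu> k powr (1 / real k)) powr real k"
      using elim assms(1)[of k] by (simp add: powr_powr)
    also have "\<dots> \<le> exp \<epsilon> powr real k"
      using elim by (intro powr_mono2) auto
    finally show ?case by (simp add: powr_def mult.commute)
  qed
qed

lemma (in prob_space) AE_eventually_not_if_prob_le:
  assumes "\<And>k. {\<omega> \<in> space M. Q k \<omega>} \<in> events"
    and "eventually (\<lambda>k. prob {\<omega> \<in> space M. Q k \<omega>} \<le> C * exp (- \<epsilon> * real k)) sequentially" and "0 < \<epsilon>"
  shows "AE \<omega> in M. eventually (\<lambda>k. \<not> Q k \<omega>) sequentially"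
proof -
  have "summable (\<lambda>k. C * exp (- \<epsilon>) ^ k)"
    using \<open>0 < \<epsilon>\<close> by (intro summable_mult summable_geometric) simp
  moreover have "C * exp (- \<epsilon>) ^ k = C * exp (- \<epsilon> * real k)" for k
    by (simp add: exp_of_nat_mult[symmetric] mult.commute)
  ultimately have "summable (\<lambda>k. C * exp (- \<epsilon> * real k))"
    by simp
  then have "summable (\<lambda>k. prob {\<omega> \<in> space M. Q k \<omega>})"
    by (rule summable_comparison_test_ev[rotated]) (use assms(2) in simp)
  then have "AE \<omega> in M. eventually (\<lambda>k. \<omega> \<in> space M - {\<omega> \<in> space M. Q k \<omega>}) sequentially"
    using assms(1) by (intro borel_cantelli_AE1) (auto simp: emeasure_eq_measure)
  then show ?thesis
    by eventually_elim (auto elim: eventually_mono)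
qed

text \<open>
  By Markov's inequality for the \<open>s\<close>-th moment, the \<open>k\<close>-th tail has probability at most \<open>exp (- \<epsilon> * s * k)\<close>
  times the moment. The root condition allows the moment to grow no faster than \<open>exp (\<epsilon> * s / 2 * k)\<close>, so
  half of the exponent survives and Borel--Cantelli applies.
\<close>
lemma (in prob_space) AE_eventually_le_exp:
  fixes X :: "nat \<Rightarrow> 'a \<Rightarrow> real"
  assumes nonneg: "\<And>k \<omega>. 0 \<le> X k \<omega>" and "0 < s" and int: "\<And>k. integrable M (\<lambda>\<omega>. X k \<omega> powr s)"
    and limsup: "limsup (\<lambda>k. ereal (expectation (\<lambda>\<omega>. X k \<omega> powr s) powr (1 / real k))) \<le> 1"
    and [measurable]: "\<And>k. random_variable borel (X k)"
    and "0 < \<epsilon>"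
  shows "AE \<omega> in M. eventually (\<lambda>k. X k \<omega> \<le> exp (\<epsilon> * real k)) sequentially"
proof -
  have "AE \<omega> in M. eventually (\<lambda>k. \<not> exp (\<epsilon> * real k) < X k \<omega>) sequentially"
  proof (rule AE_eventually_not_if_prob_le[where C = 1 and \<epsilon> = "\<epsilon> * s / 2"])
    have "0 < \<epsilon> * s / 2" using assms by simp
    then have "eventually (\<lambda>k. expectation (\<lambda>\<omega>. X k \<omega> powr s) \<le> exp (\<epsilon> * s / 2 * real k)) sequentially"
      by (intro limsup_root_bound limsup) (auto intro: integral_nonneg_AE)
    then show "eventually (\<lambda>k. prob {\<omega> \<in> space M. exp (\<epsilon> * real k) < X k \<omega>} \<le> 1 * exp (- (\<epsilon> * s / 2) * real k)) sequentially"
    proof eventually_elim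
      case (elim k)
      have pow: "exp (\<epsilon> * real k) powr s = exp (\<epsilon> * s * real k)"
        by (simp add: powr_def mult_ac)
      have "prob {\<omega> \<in> space M. exp (\<epsilon> * real k) < X k \<omega>}
          \<le> prob {\<omega> \<in> space M. exp (\<epsilon> * s * real k) \<le> X k \<omega> powr s}"
        unfolding pow[symmetric] using \<open>0 < s\<close> by (intro finite_measure_mono) (auto intro: powr_mono2)
      also have "\<dots> \<le> expectation (\<lambda>\<omega>. X k \<omega> powr s) / exp (\<epsilon> * s * real k)"
        by (rule integral_Markov_inequality_measure[OF int, of "{}"]) auto
      also have "\<dots> \<le> exp (\<epsilon> * s / 2 * real k) / exp (\<epsilon> * s * real k)"
        using elim by (intro divide_right_mono) auto
      also have "\<dots> = 1 * exp (- (\<epsilon> * s / 2) * real k)"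
        by (simp add: field_simps flip: exp_diff exp_add)
      finally show ?case .
    qed
  qed (use assms in auto)
  then show ?thesis by (simp add: not_less)
qed

lemma (in prob_space) prob_le_density_bound:
  fixes X :: "'a \<Rightarrow> real" and f :: "real \<Rightarrow> real"
  assumes distr: "distributed M lborel X (\<lambda>x. ennreal (f x))" and nonneg: "\<And>\<omega>. 0 \<le> X \<omega>"
    and f: "\<And>x. 0 \<le> x \<Longrightarrow> x \<le> y \<Longrightarrow> f x \<le> B" and "0 \<le> B" "0 \<le> y"
  shows "prob {\<omega> \<in> space M. X \<omega> \<le> y} \<le> B * y"
proof -
  have eq: "{\<omega> \<in> space M. X \<omega> \<le> y} = X -` {0..y} \<inter> space M"
    using nonneg by auto
  have "emeasure M (X -` {0..y} \<inter> space M) = (\<integral>\<^sup>+x. ennreal (f x) * indicator {0..y} x \<partial>lborel)"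
    using distr by (rule distributed_emeasure) simp
  also have "\<dots> \<le> (\<integral>\<^sup>+x. ennreal B * indicator {0..y} x \<partial>lborel)"
    using f by (intro nn_integral_mono) (auto simp: indicator_def intro: ennreal_leI)
  also have "\<dots> = ennreal (B * y)"
    using \<open>0 \<le> B\<close> \<open>0 \<le> y\<close> by (simp add: nn_integral_cmult_indicator ennreal_mult)
  finally show ?thesis
    unfolding eq using \<open>0 \<le> B\<close> \<open>0 \<le> y\<close> by (simp add: emeasure_eq_measure)
qed

text \<open>
  The probability of \<open>X k \<le> exp (- \<epsilon> * k)\<close> is at most \<open>B * exp (- \<epsilon> * k)\<close> once \<open>exp (- \<epsilon> * k) \<le> \<delta>\<close>, and these
  bounds are summable.
\<close>
lemma (in prob_space) AE_eventually_exp_le: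
  fixes X :: "nat \<Rightarrow> 'a \<Rightarrow> real"
  assumes small: "\<And>k y. 0 \<le> y \<Longrightarrow> y \<le> \<delta> \<Longrightarrow> prob {\<omega> \<in> space M. X k \<omega> \<le> y} \<le> B * y" and "0 < \<delta>"
    and [measurable]: "\<And>k. random_variable borel (X k)" and "0 < \<epsilon>"
  shows "AE \<omega> in M. eventually (\<lambda>k. exp (- \<epsilon> * real k) \<le> X k \<omega>) sequentially"
proof -
  have "(\<lambda>k. exp (- \<epsilon>) ^ k) \<longlonglongrightarrow> 0"
    using \<open>0 < \<epsilon>\<close> by (intro LIMSEQ_realpow_zero) auto
  then have "(\<lambda>k. exp (- \<epsilon> * real k)) \<longlonglongrightarrow> 0"
    by (simp add: exp_of_nat_mult[symmetric] mult.commute)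
  from order_tendstoD(2)[OF this \<open>0 < \<delta>\<close>]
  have "eventually (\<lambda>k. prob {\<omega> \<in> space M. X k \<omega> \<le> exp (- \<epsilon> * real k)} \<le> B * exp (- \<epsilon> * real k)) sequentially"
    by eventually_elim (intro small, auto)
  then have "AE \<omega> in M. eventually (\<lambda>k. \<not> X k \<omega> \<le> exp (- \<epsilon> * real k)) sequentially"
    by (intro AE_eventually_not_if_prob_le[OF _ _ \<open>0 < \<epsilon>\<close>]) auto
  then show ?thesis
    by eventually_elim (auto elim: eventually_mono)
qed

section \<open>Random polynomials\<close>

theorem corollary9:
  fixes M :: "'w measure"
    and a :: "nat \<Rightarrow> 'w \<Rightarrow> complex"
    and s :: real
  assumes "prob_space M"
    and "\<And>k. a k \<in> borel_measurable M"
    and "densities_bounded_near_0 M (\<lambda>k \<omega>. cmod (a k \<omega>))"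
    and "0 < s" and "s \<le> 1"
    and "\<And>k. integrable M (\<lambda>\<omega>. cmod (a k \<omega>) powr s)"
    and "limsup (\<lambda>k. ereal (prob_space.expectation M (\<lambda>\<omega>. cmod (a k \<omega>) powr s) powr (1 / real k))) = 1"
  shows "AE \<omega> in M. zeros_cluster_uniformly (\<lambda>N. random_poly a N \<omega>)"
proof -
  interpret prob_space M by fact
  note [measurable] = assms(2)
  obtain f \<delta> B where "0 < \<delta>"
    and dens: "\<forall>k. (\<forall>x. 0 \<le> f k x) \<and>
      distributed M lborel (\<lambda>\<omega>. cmod (a k \<omega>)) (\<lambda>x. ennreal (f k x)) \<and> (\<forall>x\<in>{0..\<delta>}. f k x \<le> B)"
    using assms(3) unfolding densities_bounded_near_0_def by (elim exE conjE)
  have f_nonneg: "0 \<le> f k x" and f_le: "x \<in> {0..\<delta>} \<Longrightarrow> f k x \<le> B"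
    and distr: "distributed M lborel (\<lambda>\<omega>. cmod (a k \<omega>)) (\<lambda>x. ennreal (f k x))" for k x
    using dens by blast+
  have "0 \<le> B"
    using f_nonneg[of 0 0] f_le[of 0 0] \<open>0 < \<delta>\<close> by simp
  have small: "prob {\<omega> \<in> space M. cmod (a k \<omega>) \<le> y} \<le> B * y" if "0 \<le> y" "y \<le> \<delta>" for k y
    using that f_le \<open>0 \<le> B\<close> by (intro prob_le_density_bound[OF distr]) auto
  have nonzero: "AE \<omega> in M. \<forall>k. a k \<omega> \<noteq> 0"
  proof (subst AE_all_countable, rule allI)
    fix k
    have "prob {\<omega> \<in> space M. cmod (a k \<omega>) \<le> 0} = 0"
      using small[of 0 k] \<open>0 < \<delta>\<close> by (intro antisym measure_nonneg) simp
    then have "AE \<omega> in M. \<not> cmod (a k \<omega>) \<le> 0"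
      by (subst (asm) prob_eq_0) auto
    then show "AE \<omega> in M. a k \<omega> \<noteq> 0" by simp
  qed
  \<comment> \<open>The exceptional null set depends on the exponent, so only countably many exponents are considered;
     by monotonicity arbitrarily small ones suffice.\<close>
  define e where "e j = 1 / real (Suc j)" for j
  have e: "0 < e j" for j by (simp add: e_def)
  have upper: "AE \<omega> in M. \<forall>j. eventually (\<lambda>k. cmod (a k \<omega>) \<le> exp (e j * real k)) sequentially"
    using assms(4,6,7) e by (subst AE_all_countable) (auto intro!: AE_eventually_le_exp[where s = s])
  have lower: "AE \<omega> in M. \<forall>j. eventually (\<lambda>k. exp (- e j * real k) \<le> cmod (a k \<omega>)) sequentially"
    using small \<open>0 < \<delta>\<close> e by (subst AE_all_countable, intro allI AE_eventually_exp_le[where \<delta> = \<delta> and B = B]) auto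
  show ?thesis
    using nonzero upper lower
  proof eventually_elim
    case (elim \<omega>)
    interpret subexponential_coeffs "\<lambda>k. a k \<omega>"
    proof
      fix \<epsilon> :: real assume "0 < \<epsilon>"
      then obtain j where j: "e j < \<epsilon>"
        unfolding e_def using reals_Archimedean by (metis inverse_eq_divide)
      have "exp (e j * real k) \<le> exp (\<epsilon> * real k)" "exp (- \<epsilon> * real k) \<le> exp (- e j * real k)" for k
        using j by (auto intro: mult_right_mono)
      then show "eventually (\<lambda>k. cmod (a k \<omega>) \<le> exp (\<epsilon> * real k)) sequentially"
        "eventually (\<lambda>k. exp (- \<epsilon> * real k) \<le> cmod (a k \<omega>)) sequentially"
        using elim by (blast intro: order_trans eventually_mono)+
    qed (use elim in simp)
    have "P = (\<lambda>N. random_poly a N \<omega>)"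
      by (simp add: P_def random_poly_def fun_eq_iff)
    then show ?case using zeros_cluster by simp
  qed
qed

end
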